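(* Let $T$ be a rooted, countably infinite tree without terminal vertices. Suppose that $\varphi:T\to\mathbb C$ is a function in $\mathcal L^2(T)$ such that $\widehat{\varphi}\in\mathcal L^2(T)$, where $\widehat{\varphi}(v)=(|v|+1)\varphi'(v)$ for $v\in T$. Then the following three conditions on the Toeplitz operator $T_\varphi$ are equivalent: (1) $T_\varphi$ is positive on $\mathcal L^2(T)$; (2) $T_\varphi$ is self-adjoint on $\mathcal L^2(T)$; (3) $\varphi(v)=0$ for all $v\in T$.
   Context: A tree $T$ is a locally finite graph (every vertex has finitely many neighbors) in which any two vertices are joined by exactly one path (a finite sequence of distinct, successively adjacent vertices); $T$ is identified with its set of vertices. The set of vertices is countably infinite, and a distinguished vertex $o$ is called the root. A terminal vertex is a vertex with exactly one neighbor; $T$ is assumed to have none. The length $|v|$ is the number of edges in the path from $o$ to $v$. A vertex $w$ is a descendant of $v$ if $v$ lies on the path from $o$ to $w$. For $v\neq o$, $v^-$ denotes the unique neighbor of $v$ lying on the path from $o$ to $v$ (the parent of $v$). The sector $S_v$ is the set consisting of $v$ and all its descendants. For $1\leqslant p<\infty$, $\mathcal L^p(T)$ is the space of functions $f:T\to\mathbb C$ with $\sum_{v\in T}|f(v)|^p<\infty$; $\mathcal L^2(T)$ is a complex Hilbert space with inner product $\langle f,g\rangle=\sum_{v\in T}f(v)\overline{g(v)}$. For $\varphi:T\to\mathbb C$, define $\varphi_-(v)=\varphi(v^-)$ if $v\ne o$, $\varphi_-(o)=0$, and $\varphi'(v)=\varphi(v)-\varphi_-(v)$ for all $v\in T$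 (so $\varphi'(o)=\varphi(o)$). For any $f:T\to\mathbb C$, define $(\nabla f)(u)=f(u)-\sum_{v:\,v^-=u}f(v)$, $u\in T$. For $f\in\mathcal L^1(T)$, define $(\Delta f)(u)=\sum_{v\in S_u}f(v)$, $u\in T$. The Toeplitz operator with symbol $\varphi$ on $\mathcal L^2(T)$ is $T_\varphi f=\Delta(\varphi\nabla f)$, $f\in\mathcal L^2(T)$. (It is known that, when $\varphi,\widehat\varphi\in\mathcal L^2(T)$, one has $\varphi\nabla f\in\mathcal L^1(T)$ for every $f\in\mathcal L^2(T)$ and $T_\varphi$ is a bounded operator on $\mathcal L^2(T)$.) A bounded linear operator $A$ on a complex Hilbert space $\mathscr H$ is called self-adjoint (respectively positive) if $\langle Ax,x\rangle$ is real (respectively real and nonnegative) for every $x\in\mathscr H$. *)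

theory Defs
  imports "HOL-Analysis.Analysis"
begin

text \<open>A graph is an adjacency relation on the type \<open>'v\<close>; the vertex set is all of \<open>'v\<close>, so that
  functions on the tree are exactly the functions of type \<open>'v \<Rightarrow> complex\<close>. Paths are nonempty
  vertex lists; \<open>[v]\<close> is the path from \<open>v\<close> to itself.\<close>

definition is_path :: "('v \<Rightarrow> 'v \<Rightarrow> bool) \<Rightarrow> 'v \<Rightarrow> 'v \<Rightarrow> 'v list \<Rightarrow> bool" where
  "is_path E u v p \<longleftrightarrow>
     p \<noteq> [] \<and> hd p = u \<and> last p = v \<and> distinct p \<and> successively E p"

definition terminal_vertex :: "('v \<Rightarrow> 'v \<Rightarrow> bool) \<Rightarrow> 'v \<Rightarrow> bool" where
  "terminal_vertex E v \<longleftrightarrow> card {w. E v w} = 1"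

text \<open>The root is an arbitrary vertex and carries no condition, so it is not a locale parameter.\<close>

locale infinite_tree =
  fixes E :: "'v \<Rightarrow> 'v \<Rightarrow> bool"
  assumes adj_sym: "E u v \<Longrightarrow> E v u"
    and adj_irrefl: "\<not> E v v"
    and locally_finite: "finite {w. E v w}"
    and unique_path: "\<exists>!p. is_path E u v p"
    and countable_vertices: "countable (UNIV :: 'v set)"
    and infinite_vertices: "infinite (UNIV :: 'v set)"
    and no_terminal: "\<not> terminal_vertex E v"

definition the_path :: "('v \<Rightarrow> 'v \<Rightarrow> bool) \<Rightarrow> 'v \<Rightarrow> 'v \<Rightarrow> 'v list" where
  "the_path E u v = (THE p. is_path E u v p)"

definition level :: "('v \<Rightarrow> 'v \<Rightarrow> bool) \<Rightarrow> 'v \<Rightarrow> 'v \<Rightarrow> nat" where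
  "level E r v = length (the_path E r v) - 1"

definition descendant :: "('v \<Rightarrow> 'v \<Rightarrow> bool) \<Rightarrow> 'v \<Rightarrow> 'v \<Rightarrow> 'v \<Rightarrow> bool" where
  "descendant E r v w \<longleftrightarrow> v \<in> set (the_path E r w)"

definition sector :: "('v \<Rightarrow> 'v \<Rightarrow> bool) \<Rightarrow> 'v \<Rightarrow> 'v \<Rightarrow> 'v set" where
  "sector E r v = insert v {w. descendant E r v w}"

text \<open>Meaningful only for \<open>v \<noteq> r\<close>; every use below excludes the root.\<close>

definition parent :: "('v \<Rightarrow> 'v \<Rightarrow> bool) \<Rightarrow> 'v \<Rightarrow> 'v \<Rightarrow> 'v" where
  "parent E r v = (THE u. E v u \<and> u \<in> set (the_path E r v))"

definition ell_p :: "real \<Rightarrow> ('v \<Rightarrow> complex) set" where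
  "ell_p p = {f. (\<lambda>v. cmod (f v) powr p) summable_on UNIV}"

definition ell2_inner :: "('v \<Rightarrow> complex) \<Rightarrow> ('v \<Rightarrow> complex) \<Rightarrow> complex" where
  "ell2_inner f g = (\<Sum>\<^sub>\<infinity>v. f v * cnj (g v))"

definition ell2_norm :: "('v \<Rightarrow> complex) \<Rightarrow> real" where
  "ell2_norm f = sqrt (Re (ell2_inner f f))"

definition bounded_operator_ell2 :: "(('v \<Rightarrow> complex) \<Rightarrow> ('v \<Rightarrow> complex)) \<Rightarrow> bool" where
  "bounded_operator_ell2 A \<longleftrightarrow>
     (\<forall>f\<in>ell_p 2. A f \<in> ell_p 2) \<and>
     (\<forall>f\<in>ell_p 2. \<forall>g\<in>ell_p 2. A (\<lambda>v. f v + g v) = (\<lambda>v. A f v + A g v)) \<and>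
     (\<forall>c. \<forall>f\<in>ell_p 2. A (\<lambda>v. c * f v) = (\<lambda>v. c * A f v)) \<and>
     (\<exists>C. \<forall>f\<in>ell_p 2. ell2_norm (A f) \<le> C * ell2_norm f)"

definition self_adjoint_ell2 :: "(('v \<Rightarrow> complex) \<Rightarrow> ('v \<Rightarrow> complex)) \<Rightarrow> bool" where
  "self_adjoint_ell2 A \<longleftrightarrow>
     bounded_operator_ell2 A \<and> (\<forall>f\<in>ell_p 2. ell2_inner (A f) f \<in> \<real>)"

definition positive_ell2 :: "(('v \<Rightarrow> complex) \<Rightarrow> ('v \<Rightarrow> complex)) \<Rightarrow> bool" where
  "positive_ell2 A \<longleftrightarrow>
     bounded_operator_ell2 A \<and>
     (\<forall>f\<in>ell_p 2. ell2_inner (A f) f \<in> \<real> \<and> 0 \<le> Re (ell2_inner (A f) f))"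

definition shift_minus ::
  "('v \<Rightarrow> 'v \<Rightarrow> bool) \<Rightarrow> 'v \<Rightarrow> ('v \<Rightarrow> complex) \<Rightarrow> 'v \<Rightarrow> complex" where
  "shift_minus E r \<phi> v = (if v = r then 0 else \<phi> (parent E r v))"

definition tree_deriv ::
  "('v \<Rightarrow> 'v \<Rightarrow> bool) \<Rightarrow> 'v \<Rightarrow> ('v \<Rightarrow> complex) \<Rightarrow> 'v \<Rightarrow> complex" where
  "tree_deriv E r \<phi> v = \<phi> v - shift_minus E r \<phi> v"

definition hat ::
  "('v \<Rightarrow> 'v \<Rightarrow> bool) \<Rightarrow> 'v \<Rightarrow> ('v \<Rightarrow> complex) \<Rightarrow> 'v \<Rightarrow> complex" where
  "hat E r \<phi> v = (of_nat (level E r v) + 1) * tree_deriv E r \<phi> v"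

definition nabla ::
  "('v \<Rightarrow> 'v \<Rightarrow> bool) \<Rightarrow> 'v \<Rightarrow> ('v \<Rightarrow> complex) \<Rightarrow> 'v \<Rightarrow> complex" where
  "nabla E r f u = f u - (\<Sum>v\<in>{v. v \<noteq> r \<and> parent E r v = u}. f v)"

text \<open>The sector sum converges for \<open>f \<in> ell_p 1\<close>, the domain on which it is meant; a divergent
  infinite sum is 0 by the library's convention.\<close>

definition Delta ::
  "('v \<Rightarrow> 'v \<Rightarrow> bool) \<Rightarrow> 'v \<Rightarrow> ('v \<Rightarrow> complex) \<Rightarrow> 'v \<Rightarrow> complex" where
  "Delta E r f u = (\<Sum>\<^sub>\<infinity>v\<in>sector E r u. f v)"

definition toeplitz ::
  "('v \<Rightarrow> 'v \<Rightarrow> bool) \<Rightarrow> 'v \<Rightarrow> ('v \<Rightarrow> complex) \<Rightarrow> ('v \<Rightarrow> complex) \<Rightarrow> ('v \<Rightarrow> complex)" where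
  "toeplitz E r \<phi> f = Delta E r (\<lambda>v. \<phi> v * nabla E r f v)"

end

theory Submission imports Defs begin

text \<open>Test \<open>T\<^sub>\<phi>\<close> on functions \<open>f\<close> supported on the root \<open>r\<close> and one other vertex \<open>w\<close>, with
  \<open>f(w) = 1\<close> and \<open>f(r) = c\<close>: then \<open>\<langle>T\<^sub>\<phi> f, f\<rangle> = \<phi>(w) + c\<^sup>* (c \<phi>(r) + \<phi>'(w))\<close>, where \<open>c\<^sup>*\<close> is the
  complex conjugate of \<open>c\<close>. If this is real for \<open>c = 1, -1, \<i>, -\<i>\<close>, then \<open>\<phi>'(w) = 0\<close>. Hence \<open>\<phi>\<close> is
  constant, and the only constant in \<open>\<L>\<^sup>2\<close> of an infinite set is zero.\<close>

context infinite_tree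
begin

lemma is_path_the_path: "is_path E u v (the_path E u v)"
  unfolding the_path_def by (rule theI'[OF unique_path])

lemma the_path_unique: "is_path E u v p \<Longrightarrow> the_path E u v = p"
  using unique_path is_path_the_path by blast

lemma the_path_refl: "the_path E v v = [v]"
  by (rule the_path_unique) (simp add: is_path_def)

text \<open>Dropping the last vertex of the path to \<open>v\<close> leaves a path, which by
  uniqueness is the path to its own end; that end is the parent.\<close>

lemma path_parent:
  assumes "v \<noteq> r"
  shows "E (parent E r v) v \<and> the_path E r v = the_path E r (parent E r v) @ [v]"
proof -
  let ?p = "the_path E r v"
  have p: "?p \<noteq> []" "hd ?p = r" "last ?p = v" "distinct ?p" "successively E ?p"
    using is_path_the_path[of r v] by (auto simp: is_path_def)
  define q where "q = butlast ?p"
  have pq: "?p = q @ [v]"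
    using p(1,3) unfolding q_def by (metis append_butlast_last_id)
  have "q \<noteq> []"
    using p(2) pq assms by auto
  have q: "E (last q) v" "distinct q" "successively E q" "hd q = r"
    using p pq \<open>q \<noteq> []\<close> by (auto simp: successively_append_iff)
  have last_q: "the_path E r (last q) = q"
    using q \<open>q \<noteq> []\<close> by (intro the_path_unique) (simp add: is_path_def)
  have "parent E r v = last q"
    unfolding parent_def
  proof (rule the_equality)
    show "E v (last q) \<and> last q \<in> set ?p"
      using q(1) adj_sym pq \<open>q \<noteq> []\<close> by auto
  next
    fix x
    assume x: "E v x \<and> x \<in> set ?p"
    then have "x \<in> set q"
      using adj_irrefl pq by auto
    then obtain a b where ab: "q = a @ x # b"
      by (meson split_list)
    \<comment> \<open>Stepping from \<open>x\<close> straight to \<open>v\<close> gives another path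
      from \<open>r\<close> to \<open>v\<close>; uniqueness forces \<open>b\<close> to be
      empty.\<close>
    have "is_path E r v (a @ [x, v])"
      using p q ab pq x adj_sym[of v x]
      by (auto simp: is_path_def successively_append_iff hd_append split: if_splits)
    then have "a @ [x, v] = q @ [v]"
      using the_path_unique pq by metis
    then have "q = a @ [x]"
      by simp
    then show "x = last q"
      by simp
  qed
  then show ?thesis
    using q(1) last_q pq by simp
qed

lemma sector_root: "sector E v v = UNIV"
proof -
  have "v \<in> set (the_path E v w)" for w
    using is_path_the_path[of v w] unfolding is_path_def by (metis hd_in_set)
  then show ?thesis
    by (auto simp: sector_def descendant_def)
qed

lemma root_notin_sector: "v \<noteq> r \<Longrightarrow> r \<notin> sector E r v"
  by (simp add: sector_def descendant_def the_path_refl)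

text \<open>The path to \<open>v\<close> is the path to its parent followed by \<open>v\<close>,
  without repetition, so \<open>v\<close> is not on the path to its parent.\<close>

lemma parent_notin_sector:
  assumes "v \<noteq> r"
  shows "parent E r v \<notin> sector E r v"
proof -
  have "distinct (the_path E r v)"
    using is_path_the_path by (auto simp: is_path_def)
  moreover have "parent E r v \<noteq> v"
    using path_parent[OF assms] adj_irrefl by metis
  ultimately show ?thesis
    using path_parent[OF assms] by (auto simp: sector_def descendant_def)
qed

text \<open>Children of \<open>u\<close> are neighbors of \<open>u\<close>. Finiteness matters
  because \<open>sum\<close> over an infinite set is 0 by default.\<close>

lemma finite_children: "finite {v. v \<noteq> r \<and> parent E r v = u}"
  by (rule finite_subset[OF _ locally_finite[of u]]) (use path_parent in blast)

text \<open>Induction along the path from the root: the path to the parent is one vertex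
  shorter.\<close>

lemma eq_root_if_eq_parent:
  assumes "\<And>v. v \<noteq> r \<Longrightarrow> f v = f (parent E r v)"
  shows "f v = f r"
proof (induction "length (the_path E r v)" arbitrary: v rule: less_induct)
  case less
  show ?case
  proof (cases "v = r")
    case False
    then show ?thesis
      using less[of "parent E r v"] assms path_parent[of v r] by simp
  qed simp
qed

text \<open>The root is no vertex's child, so \<open>c\<close> never enters a sum over children, and
  \<open>w\<close> enters only at its parent. Separate indicators stay correct when that parent is
  \<open>r\<close>.\<close>

lemma nabla_two_points:
  assumes "w \<noteq> r"
  shows "nabla E r (\<lambda>v. if v = w then 1 else if v = r then c else 0) u =
    (if u = w then 1 else 0) + (if u = r then c else 0) - (if u = parent E r w then 1 else 0)"
proof -
  have "(\<Sum>v\<in>{v. v \<noteq> r \<and> parent E r v = u}. if v = w then 1 else if v = r then c else 0) =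
      (\<Sum>v\<in>{v. v \<noteq> r \<and> parent E r v = u}. if v = w then 1 else 0)"
    by (rule sum.cong) auto
  then show ?thesis
    using assms by (auto simp: nabla_def finite_children)
qed

text \<open>The product of \<open>\<phi>\<close> and \<open>nabla E r f\<close> vanishes off
  \<open>?F\<close>, so the sector sums are finite. The sector of \<open>w\<close> meets
  \<open>?F\<close> only in \<open>w\<close>; the sector of \<open>r\<close> contains all of
  \<open>?F\<close>.\<close>

lemma toeplitz_two_points:
  fixes c :: complex
  assumes "w \<noteq> r"
  defines "f \<equiv> \<lambda>v. if v = w then 1 else if v = r then c else 0"
  shows "toeplitz E r \<phi> f w = \<phi> w"
    and "toeplitz E r \<phi> f r = c * \<phi> r + tree_deriv E r \<phi> w"
proof -
  let ?F = "{w, r, parent E r w}"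
  have T: "toeplitz E r \<phi> f u = (\<Sum>v\<in>?F \<inter> sector E r u.
      (if v = w then \<phi> w else 0) + (if v = r then c * \<phi> r else 0)
      - (if v = parent E r w then \<phi> (parent E r w) else 0))" for u
  proof -
    have "toeplitz E r \<phi> f u = (\<Sum>\<^sub>\<infinity>v\<in>?F \<inter> sector E r u.
        (if v = w then \<phi> w else 0) + (if v = r then c * \<phi> r else 0)
        - (if v = parent E r w then \<phi> (parent E r w) else 0))"
      unfolding toeplitz_def Delta_def f_def nabla_two_points[OF assms(1)]
      by (rule infsum_cong_neutral) (auto simp: algebra_simps)
    then show ?thesis
      by simp
  qed
  have w: "w \<in> sector E r w"
    by (simp add: sector_def)
  show "toeplitz E r \<phi> f w = \<phi> w"
    unfolding T sum.distrib sum_subtractf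
    using w assms(1) root_notin_sector[OF assms(1)] parent_notin_sector[OF assms(1)]
    by (auto simp: sum.delta)
  show "toeplitz E r \<phi> f r = c * \<phi> r + tree_deriv E r \<phi> w"
    unfolding T sum.distrib sum_subtractf
    \<comment> \<open>Keeping \<open>?F\<close> unexpanded lets \<open>sum.delta\<close> apply
      whether or not the parent of \<open>w\<close> is \<open>r\<close>.\<close>
    using assms(1) by (simp add: sector_root sum.delta tree_deriv_def shift_minus_def del: sum.insert)
qed

lemma tree_deriv_eq_0_if_real_form:
  assumes real: "\<And>f. f \<in> ell_p 2 \<Longrightarrow> ell2_inner (toeplitz E r \<phi> f) f \<in> \<real>"
    and w: "w \<noteq> r"
  shows "tree_deriv E r \<phi> w = 0"
proof -
  have form: "Im (\<phi> w + (c * \<phi> r + tree_deriv E r \<phi> w) * cnj c) = 0" for c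
  proof -
    let ?f = "\<lambda>v. if v = w then 1 else if v = r then c else 0"
    have "(\<lambda>v. cmod (?f v) powr 2) summable_on {w, r}"
      by (rule summable_on_finite) simp
    then have "?f \<in> ell_p 2"
      unfolding ell_p_def mem_Collect_eq
      by (rule summable_on_cong_neutral[THEN iffD1, rotated -1]) auto
    moreover have "ell2_inner (toeplitz E r \<phi> ?f) ?f =
        (\<Sum>\<^sub>\<infinity>v\<in>{w, r}. toeplitz E r \<phi> ?f v * cnj (?f v))"
      unfolding ell2_inner_def by (rule infsum_cong_neutral) auto
    ultimately have "\<phi> w + (c * \<phi> r + tree_deriv E r \<phi> w) * cnj c \<in> \<real>"
      using real[of ?f] w by (simp add: toeplitz_two_points[OF w])
    then show ?thesis
      by (simp add: complex_is_Real_iff)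
  qed
  show ?thesis
    \<comment> \<open>The values \<open>c\<close> and \<open>-c\<close> share the term in
      \<open>\<phi> r\<close>, so subtracting leaves only the derivative times \<open>cnj c\<close>:
      its imaginary part vanishes by \<open>c = 1\<close>, its real part by
      \<open>c = \<i>\<close>.\<close>
    using form[of 1] form[of "-1"] form[of \<i>] form[of "-\<i>"]
    by (simp add: complex_eq_iff)
qed

end

text \<open>A nonzero constant is not summable over an infinite set, and \<open>powr\<close>
  vanishes only at base 0.\<close>

lemma ell_p_const_imp_0:
  assumes "infinite (UNIV :: 'a set)" "(\<lambda>_ :: 'a. c) \<in> ell_p p"
  shows "c = 0"
proof -
  have "(\<lambda>_ :: 'a. cmod c powr p) summable_on UNIV"
    using assms(2) by (simp add: ell_p_def)
  then have "cmod c powr p = 0"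
    using infsum_diverge_constant[OF assms(1)] by blast
  then show ?thesis
    by simp
qed

text \<open>Positivity includes boundedness; the norm bound holds with constant 0.\<close>

lemma positive_ell2_zero: "positive_ell2 (\<lambda>_ _. 0)"
  by (auto simp: positive_ell2_def bounded_operator_ell2_def ell_p_def ell2_inner_def
      ell2_norm_def intro!: exI[of _ 0])

theorem theorem4p1:
  fixes E :: "'v \<Rightarrow> 'v \<Rightarrow> bool" and r :: 'v and \<phi> :: "'v \<Rightarrow> complex"
  assumes "infinite_tree E"
    and "\<phi> \<in> ell_p 2"
    and "hat E r \<phi> \<in> ell_p 2"
  shows "(positive_ell2 (toeplitz E r \<phi>) \<longleftrightarrow> self_adjoint_ell2 (toeplitz E r \<phi>)) \<and>
    (self_adjoint_ell2 (toeplitz E r \<phi>) \<longleftrightarrow> (\<forall>v. \<phi> v = 0))"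
proof -
  interpret infinite_tree E by fact
  have "positive_ell2 (toeplitz E r \<phi>) \<Longrightarrow> self_adjoint_ell2 (toeplitz E r \<phi>)"
    by (simp add: positive_ell2_def self_adjoint_ell2_def)
  moreover have "\<forall>v. \<phi> v = 0" if "self_adjoint_ell2 (toeplitz E r \<phi>)"
  proof -
    have "\<phi> v = \<phi> (parent E r v)" if "v \<noteq> r" for v
      using tree_deriv_eq_0_if_real_form[of r \<phi> v] \<open>self_adjoint_ell2 _\<close> that
      by (simp add: self_adjoint_ell2_def tree_deriv_def shift_minus_def)
    then have const: "\<phi> v = \<phi> r" for v
      by (rule eq_root_if_eq_parent)
    then have "\<phi> = (\<lambda>_. \<phi> r)"
      by auto
    then have "\<phi> r = 0"
      using ell_p_const_imp_0 infinite_vertices assms(2) by metis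
    then show ?thesis
      using const by simp
  qed
  moreover have "positive_ell2 (toeplitz E r \<phi>)" if "\<forall>v. \<phi> v = 0"
  proof -
    have "toeplitz E r \<phi> = (\<lambda>_ _. 0)"
      using that by (intro ext) (simp add: toeplitz_def Delta_def)
    then show ?thesis
      using positive_ell2_zero by metis
  qed
  ultimately show ?thesis
    by blast
qed

end
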